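(* Let $n$ be a positive integer, let $N_*$ be a finite index set and let $N \subsetneq N_*$ with $p := \#N < p_* := \#N_* < n$. Let $\mathbf{y} \in \mathbb{R}^n$ and $\mathbf{x}_\nu \in \mathbb{R}^n$, $\nu \in N$, be fixed vectors such that the $p+1$ vectors $\mathbf{y}$ and $\mathbf{x}_\nu$, $\nu \in N$, are linearly independent. Let $\mathbf{z}_\nu$, $\nu \in N_* \setminus N$, be stochastically independent random vectors with $\mathbf{z}_\nu \sim \mathcal{N}_n(\mathbf{0}, \mathbf{I}_n)$, and set $\mathbf{x}_\nu := \mathbf{z}_\nu$ for $\nu \in N_* \setminus N$. For $M \subset N_*$ let $\mathbb{V}_M := \mathrm{span}(\mathbf{x}_\nu : \nu \in M)$, let $\widehat{\mathbf{y}}_M$ be the orthogonal projection of $\mathbf{y}$ onto $\mathbb{V}_M$, and let $\mathrm{SS}_M := \|\mathbf{y} - \widehat{\mathbf{y}}_M\|^2$. Then $\mathrm{SS}_{N_*}$ is a random variable and \[ \frac{\mathrm{SS}_{N_*}}{\mathrm{SS}_N} \ \sim \ \mathrm{Beta}\bigl( (n - p_* )/2, \, (p_* - p)/2 \bigr). \]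
   Context: $\mathcal{N}_n(\mathbf{0},\mathbf{I}_n)$ is the standard Gaussian distribution on $\mathbb{R}^n$ ($\mathbf{I}_n$ the identity matrix). $\mathrm{Beta}(a,b)$ denotes the beta distribution on $(0,1)$ with density proportional to $u^{a-1}(1-u)^{b-1}$. If $N=\emptyset$, $\mathbb{V}_\emptyset := \{\mathbf{0}\}$ and $\widehat{\mathbf{y}}_\emptyset := \mathbf{0}$. *)

theory Defs
  imports "HOL-Probability.Probability"
begin

definition std_gauss_density :: "real ^ 'n \<Rightarrow> real" where
  "std_gauss_density x = (2 * pi) powr (- real CARD('n) / 2) * exp (- (norm x)\<^sup>2 / 2)"

definition beta_density :: "real \<Rightarrow> real \<Rightarrow> real \<Rightarrow> real" where
  "beta_density a b u =
     (if 0 < u \<and> u < 1 then u powr (a - 1) * (1 - u) powr (b - 1) / Beta a b else 0)"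

definition orth_proj :: "'a::real_inner set \<Rightarrow> 'a \<Rightarrow> 'a" where
  "orth_proj V y = (THE v. v \<in> V \<and> (\<forall>w\<in>V. inner (y - v) w = 0))"

definition SS :: "('i \<Rightarrow> 'a::real_inner) \<Rightarrow> 'a \<Rightarrow> 'i set \<Rightarrow> real" where
  "SS x y M = (norm (y - orth_proj (span (x ` M)) y))\<^sup>2"

end

theory Submission
  imports Defs
begin

text \<open>
  Adjoining one Gaussian vector \<open>z\<close> to a fixed subspace \<open>V\<close> of dimension \<open>k\<close>, with
  \<open>y \<notin> V\<close>, multiplies the residual sum of squares of \<open>y\<close> by
  \<open>1 - \<langle>u, z\<rangle>\<^sup>2 / |z'|\<^sup>2\<close>, where \<open>z'\<close> is the component of \<open>z\<close> orthogonal to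
  \<open>V\<close> and \<open>u\<close> the normalized residual of \<open>y\<close>. In an orthonormal basis adapted to \<open>V\<close>
  and \<open>u\<close> this factor is a ratio of sums of squares of independent standard normal variables,
  so it is \<open>Beta((n - k - 1)/2, 1/2)\<close>-distributed. Almost surely \<open>y\<close> still lies outside
  the enlarged space, hence conditionally on \<open>z\<close> the remaining vectors contribute a factor whose
  law does not depend on \<open>z\<close>. By induction the ratio is a product of independent beta
  variables, and \<open>Beta(a, b) * Beta(a + b, c) = Beta(a, b + c)\<close>.
\<close>

section \<open>Gamma and beta laws\<close>

text \<open>The gamma law of shape \<open>a\<close> and rate 1. Half the square of a standard normal
  variable has this law with shape 1/2, so halving the squares below avoids a scale
  parameter.\<close>

definition gamma_density :: "real \<Rightarrow> real \<Rightarrow> real" where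
  "gamma_density a x = (if 0 < x then x powr (a - 1) * exp (- x) / Gamma a else 0)"

lemma gamma_density_nonneg [simp]: "a > 0 \<Longrightarrow> 0 \<le> gamma_density a x"
  using Gamma_real_pos[of a] by (simp add: gamma_density_def)

lemma Beta_real_pos: "a > 0 \<Longrightarrow> b > 0 \<Longrightarrow> 0 < Beta a (b :: real)"
  by (simp add: Beta_def)

lemma beta_density_nonneg [simp]: "a > 0 \<Longrightarrow> b > 0 \<Longrightarrow> 0 \<le> beta_density a b u"
  using Beta_real_pos[of a b] by (simp add: beta_density_def)

lemma borel_measurable_gamma_density [measurable]: "gamma_density a \<in> borel_measurable borel"
  unfolding gamma_density_def by measurable

lemma borel_measurable_beta_density [measurable]: "beta_density a b \<in> borel_measurable borel"
  unfolding beta_density_def by measurable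

lemma nn_integral_gamma_density:
  assumes "a > 0"
  shows "(\<integral>\<^sup>+x. gamma_density a x \<partial>lborel) = 1"
proof -
  have *: "((\<lambda>t. t powr (a - 1) / exp t / Gamma a) has_integral Gamma a / Gamma a) {0..}"
    by (intro has_integral_divide Gamma_integral_real assms)
  \<comment> \<open>At \<open>t = 0\<close> both sides vanish because \<open>0 powr c = 0\<close>,
    so the closed half-line may replace the open one.\<close>
  have eq: "gamma_density a = (\<lambda>t. if t \<in> {0..} then t powr (a - 1) / exp t / Gamma a else 0)"
    by (auto simp: gamma_density_def fun_eq_iff exp_minus field_simps)
  have "(gamma_density a has_integral Gamma a / Gamma a) UNIV"
    using * by (simp only: eq has_integral_restrict_UNIV)
  then have "(gamma_density a has_integral 1) UNIV"
    using Gamma_real_pos[OF assms] by simp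
  from nn_integral_has_integral_lborel[OF _ _ this] show ?thesis
    using assms by simp
qed

lemma nn_integral_beta_density:
  assumes "a > 0" "b > 0"
  shows "(\<integral>\<^sup>+x. beta_density a b x \<partial>lborel) = 1"
proof -
  have *: "((\<lambda>t. t powr (a - 1) * (1 - t) powr (b - 1) / Beta a b) has_integral Beta a b / Beta a b) {0..1}"
    by (intro has_integral_divide has_integral_Beta_real assms)
  \<comment> \<open>The endpoints 0 and 1 agree as well, again by
    \<open>0 powr c = 0\<close>.\<close>
  have eq: "beta_density a b = (\<lambda>t. if t \<in> {0..1} then t powr (a - 1) * (1 - t) powr (b - 1) / Beta a b else 0)"
    by (auto simp: beta_density_def fun_eq_iff)
  have "(beta_density a b has_integral Beta a b / Beta a b) UNIV"
    using * by (simp only: eq has_integral_restrict_UNIV)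
  then have "(beta_density a b has_integral 1) UNIV"
    using Beta_real_pos[OF assms] by simp
  from nn_integral_has_integral_lborel[OF _ _ this] show ?thesis
    using assms by simp
qed

text \<open>Under \<open>x = s * t\<close>, \<open>y = s - s * t\<close> the Jacobian is
  \<open>s\<close>, the exponentials multiply to \<open>exp (- s)\<close>, and the powers of
  \<open>s\<close> collect to \<open>s powr (a + b - 1)\<close>. Hence the joint density of sum and
  ratio factorizes.\<close>

lemma gamma_density_mult_eq_beta:
  assumes "a > 0" "b > 0" "s > 0"
  shows "s * (gamma_density a (s * t) * gamma_density b (s - s * t)) =
         gamma_density (a + b) s * beta_density a b t"
proof (cases "0 < t \<and> t < 1")
  case True
  have e: "s - s * t = s * (1 - t)" by (simp add: algebra_simps)
  have G: "Gamma a > 0" "Gamma b > 0" "Gamma (a + b) > 0"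
    using assms by auto
  have s: "s powr (a + b - 1) = s powr (a - 1) * s powr (b - 1) * s"
    using assms by (simp add: powr_diff powr_add field_simps)
  have "exp (- s) = exp (- (s * t)) * exp (- (s * (1 - t)))"
    by (simp only: exp_add[symmetric]) (simp add: algebra_simps)
  \<comment> \<open>The rearrangement is stated for arbitrary factors, so the powers stay
    unexpanded. Here \<open>g3\<close> stands for \<open>Gamma (a + b)\<close>, which is inserted
    and cancels.\<close>
  moreover have "s * (p * t1 * e1 / g1 * (q * t2 * e2 / g2)) =
      p * q * s * (e1 * e2) / g3 * (t1 * t2 / (g1 * g2 / g3))"
    if "g3 > 0" for p q t1 t2 e1 e2 g1 g2 g3 :: real
    using that by simp
  ultimately show ?thesis
    using True assms G(3)[THEN less_imp_neq] by (simp add: e s gamma_density_def beta_density_def Beta_def powr_mult)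
next
  case False
  then have "s * t \<le> 0 \<or> s - s * t \<le> 0"
    using assms by (auto simp: mult_le_0_iff)
  then show ?thesis
    using False by (auto simp: gamma_density_def beta_density_def)
qed

text \<open>For independent gamma variables, sum and ratio are independent with gamma and beta laws,
  tested against an arbitrary nonnegative \<open>F\<close>. The planar change of variables is done
  one coordinate at a time: \<open>y = s - x\<close> for fixed \<open>x\<close>, then, after Fubini,
  \<open>x = s * t\<close> for fixed \<open>s\<close>.\<close>

lemma nn_integral_gamma_sum_ratio:
  fixes F :: "real \<Rightarrow> real \<Rightarrow> ennreal"
  assumes a: "a > 0" and b: "b > 0"
    and F[measurable]: "case_prod F \<in> borel_measurable (borel \<Otimes>\<^sub>M borel)"
  shows "(\<integral>\<^sup>+x. gamma_density a x * (\<integral>\<^sup>+y. gamma_density b y * F (x + y) (x / (x + y)) \<partial>lborel) \<partial>lborel) =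
         (\<integral>\<^sup>+s. gamma_density (a + b) s * (\<integral>\<^sup>+t. beta_density a b t * F s t \<partial>lborel) \<partial>lborel)"
    (is "?L = ?R")
proof -
  have "?L = (\<integral>\<^sup>+x. \<integral>\<^sup>+s. ennreal (gamma_density a x * gamma_density b (s - x)) * F s (x / s) \<partial>lborel \<partial>lborel)"
  proof (intro nn_integral_cong)
    fix x :: real
    have "(\<integral>\<^sup>+y. gamma_density b y * F (x + y) (x / (x + y)) \<partial>lborel) =
        (\<integral>\<^sup>+s. gamma_density b (s - x) * F s (x / s) \<partial>lborel)"
      by (subst nn_integral_real_affine[where c = 1 and t = "-x"]) auto
    then show "gamma_density a x * (\<integral>\<^sup>+y. gamma_density b y * F (x + y) (x / (x + y)) \<partial>lborel) =
        (\<integral>\<^sup>+s. ennreal (gamma_density a x * gamma_density b (s - x)) * F s (x / s) \<partial>lborel)"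
      using a b by (simp add: nn_integral_cmult ennreal_mult mult.assoc)
  qed
  also have "\<dots> = (\<integral>\<^sup>+s. \<integral>\<^sup>+x. ennreal (gamma_density a x * gamma_density b (s - x)) * F s (x / s) \<partial>lborel \<partial>lborel)"
    by (rule lborel_pair.Fubini') measurable
  also have "\<dots> = ?R"
  proof (intro nn_integral_cong)
    fix s :: real
    show "(\<integral>\<^sup>+x. ennreal (gamma_density a x * gamma_density b (s - x)) * F s (x / s) \<partial>lborel) =
        gamma_density (a + b) s * (\<integral>\<^sup>+t. beta_density a b t * F s t \<partial>lborel)"
    proof (cases "s > 0")
      case True
      have "(\<integral>\<^sup>+x. ennreal (gamma_density a x * gamma_density b (s - x)) * F s (x / s) \<partial>lborel) =
        ennreal s * (\<integral>\<^sup>+t. ennreal (gamma_density a (s * t) * gamma_density b (s - s * t)) * F s t \<partial>lborel)"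
        using True by (subst nn_integral_real_affine[where c = s and t = 0]) auto
      also have "\<dots> = (\<integral>\<^sup>+t. ennreal (s * (gamma_density a (s * t) * gamma_density b (s - s * t))) * F s t \<partial>lborel)"
        using True a b by (subst nn_integral_cmult[symmetric]) (auto simp: ennreal_mult mult.assoc)
      also have "\<dots> = (\<integral>\<^sup>+t. gamma_density (a + b) s * (beta_density a b t * F s t) \<partial>lborel)"
        unfolding gamma_density_mult_eq_beta[OF a b True]
        using a b by (auto simp: ennreal_mult mult.assoc)
      also have "\<dots> = gamma_density (a + b) s * (\<integral>\<^sup>+t. beta_density a b t * F s t \<partial>lborel)"
        by (rule nn_integral_cmult) measurable
      finally show ?thesis .
    next
      case False
      \<comment> \<open>For \<open>s \<le> 0\<close> the numbers \<open>x\<close> and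
        \<open>s - x\<close> cannot both be positive.\<close>
      then have "ennreal (gamma_density a x * gamma_density b (s - x)) = 0" for x
        by (auto simp: gamma_density_def)
      moreover have "gamma_density (a + b) s = 0"
        using False by (simp add: gamma_density_def)
      ultimately show ?thesis
        by (simp only: mult_zero_left nn_integral_const ennreal_0)
    qed
  qed
  finally show ?thesis .
qed

lemma nn_integral_gamma_sum:
  fixes f :: "real \<Rightarrow> ennreal"
  assumes "a > 0" "b > 0" and [measurable]: "f \<in> borel_measurable borel"
  shows "(\<integral>\<^sup>+x. gamma_density a x * (\<integral>\<^sup>+y. gamma_density b y * f (x + y) \<partial>lborel) \<partial>lborel) =
         (\<integral>\<^sup>+s. gamma_density (a + b) s * f s \<partial>lborel)"
  using nn_integral_gamma_sum_ratio[of a b "\<lambda>s t. f s"] assms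
  by (simp add: nn_integral_multc nn_integral_beta_density)

lemma nn_integral_gamma_ratio:
  fixes f :: "real \<Rightarrow> ennreal"
  assumes "a > 0" "b > 0" and [measurable]: "f \<in> borel_measurable borel"
  shows "(\<integral>\<^sup>+x. gamma_density a x * (\<integral>\<^sup>+y. gamma_density b y * f (x / (x + y)) \<partial>lborel) \<partial>lborel) =
         (\<integral>\<^sup>+t. beta_density a b t * f t \<partial>lborel)"
  using nn_integral_gamma_sum_ratio[of a b "\<lambda>s t. f t"] assms
  by (simp add: nn_integral_multc nn_integral_gamma_density)

text \<open>For independent gamma variables \<open>X\<close>, \<open>Y\<close>, \<open>Z\<close> write
  \<open>X / (X + Y + Z)\<close> as \<open>X / (X + Y) * ((X + Y) / (X + Y + Z))\<close>.\<close>

lemma nn_integral_beta_product: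
  fixes f :: "real \<Rightarrow> ennreal"
  assumes a: "a > 0" and b: "b > 0" and c: "c > 0" and [measurable]: "f \<in> borel_measurable borel"
  shows "(\<integral>\<^sup>+s. beta_density (a + b) c s * (\<integral>\<^sup>+t. beta_density a b t * f (t * s) \<partial>lborel) \<partial>lborel) =
         (\<integral>\<^sup>+u. beta_density a (b + c) u * f u \<partial>lborel)"
proof -
  have "(\<integral>\<^sup>+u. beta_density a (b + c) u * f u \<partial>lborel) =
    (\<integral>\<^sup>+x. gamma_density a x * (\<integral>\<^sup>+y. gamma_density (b + c) y * f (x / (x + y)) \<partial>lborel) \<partial>lborel)"
    using assms by (subst nn_integral_gamma_ratio) auto
  also have "\<dots> = (\<integral>\<^sup>+x. gamma_density a x * (\<integral>\<^sup>+y. gamma_density b y *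
      (\<integral>\<^sup>+z. gamma_density c z * f (x / (x + y + z)) \<partial>lborel) \<partial>lborel) \<partial>lborel)"
    using assms by (subst nn_integral_gamma_sum[symmetric]) (auto simp: add.assoc)
  also have "\<dots> = (\<integral>\<^sup>+x. gamma_density a x * (\<integral>\<^sup>+y. gamma_density b y *
      (\<integral>\<^sup>+z. gamma_density c z * f (x / (x + y) * ((x + y) / (x + y + z))) \<partial>lborel) \<partial>lborel) \<partial>lborel)"
  proof (intro nn_integral_cong)
    fix x :: real
    \<comment> \<open>Cancelling \<open>x + y\<close> needs it to be nonzero. Where \<open>x\<close>
      or \<open>y\<close> is not positive, the density in front vanishes.\<close>
    have "gamma_density b y * (\<integral>\<^sup>+z. gamma_density c z * f (x / (x + y + z)) \<partial>lborel) =
        gamma_density b y * (\<integral>\<^sup>+z. gamma_density c z * f (x / (x + y) * ((x + y) / (x + y + z))) \<partial>lborel)"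
      if "x > 0" for y
      by (cases "y > 0") (use that in \<open>auto simp: gamma_density_def\<close>)
    then show "gamma_density a x * (\<integral>\<^sup>+y. gamma_density b y *
        (\<integral>\<^sup>+z. gamma_density c z * f (x / (x + y + z)) \<partial>lborel) \<partial>lborel) =
      gamma_density a x * (\<integral>\<^sup>+y. gamma_density b y *
        (\<integral>\<^sup>+z. gamma_density c z * f (x / (x + y) * ((x + y) / (x + y + z))) \<partial>lborel) \<partial>lborel)"
      by (cases "x > 0") (auto simp: gamma_density_def)
  qed
  also have "\<dots> = (\<integral>\<^sup>+s. gamma_density (a + b) s * (\<integral>\<^sup>+t. beta_density a b t *
      (\<integral>\<^sup>+z. gamma_density c z * f (t * (s / (s + z))) \<partial>lborel) \<partial>lborel) \<partial>lborel)"
    by (rule nn_integral_gamma_sum_ratio[OF a b]) measurable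
  also have "\<dots> = (\<integral>\<^sup>+s. gamma_density (a + b) s * (\<integral>\<^sup>+z. gamma_density c z *
      (\<integral>\<^sup>+t. beta_density a b t * f (t * (s / (s + z))) \<partial>lborel) \<partial>lborel) \<partial>lborel)"
  \<comment> \<open>The ratio \<open>t\<close> is independent of \<open>s\<close> and
    \<open>z\<close>, so its integral moves innermost. The pair \<open>s\<close>, \<open>z\<close>
    can then be replaced by the ratio \<open>s / (s + z)\<close>.\<close>
  proof -
    have "(\<integral>\<^sup>+t. beta_density a b t * (\<integral>\<^sup>+z. gamma_density c z * f (t * (s / (s + z))) \<partial>lborel) \<partial>lborel) =
      (\<integral>\<^sup>+z. gamma_density c z * (\<integral>\<^sup>+t. beta_density a b t * f (t * (s / (s + z))) \<partial>lborel) \<partial>lborel)"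
      (is "?A = ?B") for s
    proof -
      have "?A = (\<integral>\<^sup>+t. \<integral>\<^sup>+z. beta_density a b t * (gamma_density c z * f (t * (s / (s + z)))) \<partial>lborel \<partial>lborel)"
        by (intro nn_integral_cong nn_integral_cmult[symmetric]) measurable
      also have "\<dots> = (\<integral>\<^sup>+z. \<integral>\<^sup>+t. beta_density a b t * (gamma_density c z * f (t * (s / (s + z)))) \<partial>lborel \<partial>lborel)"
        by (rule lborel_pair.Fubini') measurable
      also have "\<dots> = (\<integral>\<^sup>+z. \<integral>\<^sup>+t. gamma_density c z * (beta_density a b t * f (t * (s / (s + z)))) \<partial>lborel \<partial>lborel)"
        by (simp add: mult.left_commute)
      also have "\<dots> = ?B"
        by (intro nn_integral_cong nn_integral_cmult) measurable
      finally show ?thesis .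
    qed
    then show ?thesis by simp
  qed
  also have "\<dots> = (\<integral>\<^sup>+s. beta_density (a + b) c s * (\<integral>\<^sup>+t. beta_density a b t * f (t * s) \<partial>lborel) \<partial>lborel)"
    using assms by (intro nn_integral_gamma_ratio) auto
  finally show ?thesis ..
qed

section \<open>Squares of standard normal variables\<close>

lemma nn_integral_even:
  fixes f :: "real \<Rightarrow> ennreal"
  assumes [measurable]: "f \<in> borel_measurable borel" and even: "\<And>x. f (- x) = f x"
  shows "(\<integral>\<^sup>+x. f x \<partial>lborel) = 2 * (\<integral>\<^sup>+x. f x * indicator {0<..} x \<partial>lborel)"
proof -
  have "(\<integral>\<^sup>+x. f x \<partial>lborel) = (\<integral>\<^sup>+x. f x * indicator {0<..} x + f x * indicator {..<0} x \<partial>lborel)"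
  proof (rule nn_integral_cong_AE)
    show "AE x in lborel. f x = f x * indicator {0<..} x + f x * indicator {..<0} x"
      using AE_lborel_singleton[of "0::real"] by eventually_elim (auto simp: indicator_def)
  qed
  also have "\<dots> = (\<integral>\<^sup>+x. f x * indicator {0<..} x \<partial>lborel) + (\<integral>\<^sup>+x. f x * indicator {..<0} x \<partial>lborel)"
    by (rule nn_integral_add) measurable
  also have "(\<integral>\<^sup>+x. f x * indicator {..<0} x \<partial>lborel) = (\<integral>\<^sup>+x. f x * indicator {0<..} x \<partial>lborel)"
    by (subst nn_integral_real_affine[where c = "-1" and t = 0]) (auto simp: even indicator_def)
  finally show ?thesis
    by (simp add: mult_2)
qed

text \<open>The substitution \<open>s = x^2 / 2\<close> is made on \<open>[0, n]\<close> for each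
  natural \<open>n\<close>; monotone convergence extends it to the half-line.\<close>

lemma nn_integral_half_square_substitution:
  fixes f :: "real \<Rightarrow> ennreal"
  assumes [measurable]: "f \<in> borel_measurable borel"
  shows "(\<integral>\<^sup>+s. f s * indicator {0..} s \<partial>lborel) =
         (\<integral>\<^sup>+x. f (x\<^sup>2 / 2) * ennreal x * indicator {0..} x \<partial>lborel)"
proof -
  have *: "(\<integral>\<^sup>+s. f s * indicator {0..(real n)\<^sup>2 / 2} s \<partial>lborel) =
         (\<integral>\<^sup>+x. f (x\<^sup>2 / 2) * ennreal x * indicator {0..real n} x \<partial>lborel)" for n
  proof (cases "n = 0")
    \<comment> \<open>For \<open>n = 0\<close> the interval of integration is a single point, a null
      set, so both integrals are zero.\<close>
    case True
    have "(\<integral>\<^sup>+s. f s * indicator {0..0} s \<partial>lborel) = 0" for f :: "real \<Rightarrow> ennreal"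
      using AE_lborel_singleton[of "0::real"]
      by (subst nn_integral_cong_AE[where v = "\<lambda>_. 0"]) (auto elim!: eventually_mono)
    with True show ?thesis by simp
  next
    case False
    have "((\<lambda>x. x\<^sup>2 / 2) has_real_derivative x) (at x)" for x :: real
      by (auto intro!: derivative_eq_intros)
    with False show ?thesis
      using nn_integral_substitution_aux[of f 0 "real n" "\<lambda>x. x\<^sup>2 / 2" "\<lambda>x. x"]
      by simp
  qed
  have sup: "(\<integral>\<^sup>+s. g s * indicator {0..} s \<partial>lborel) = (SUP n. \<integral>\<^sup>+s. g s * indicator {0..u n} s \<partial>lborel)"
    if [measurable]: "g \<in> borel_measurable borel" and u: "incseq u" "filterlim u at_top sequentially"
    for g :: "real \<Rightarrow> ennreal" and u :: "nat \<Rightarrow> real"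
  proof -
    have "(SUP n. g s * indicator {0..u n} s) = g s * indicator {0..} s" for s
    proof (rule antisym)
      show "(SUP n. g s * indicator {0..u n} s) \<le> g s * indicator {0..} s"
        by (auto intro!: SUP_least simp: indicator_def)
      obtain n where "s \<le> u n"
        using u(2) by (auto simp: filterlim_at_top eventually_sequentially)
      then have "g s * indicator {0..} s \<le> g s * indicator {0..u n} s"
        by (auto simp: indicator_def)
      also have "\<dots> \<le> (SUP n. g s * indicator {0..u n} s)"
        by (rule SUP_upper) simp
      finally show "g s * indicator {0..} s \<le> (SUP n. g s * indicator {0..u n} s)" .
    qed
    then show ?thesis
      using u(1)
      by (subst nn_integral_monotone_convergence_SUP[symmetric])
         (auto simp: incseq_def le_fun_def indicator_def intro: order_trans)
  qed
  have i1: "incseq (\<lambda>n. (real n)\<^sup>2 / 2)"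
    by (auto simp: incseq_def intro!: divide_right_mono power_mono)
  have i2: "filterlim (\<lambda>n. (real n)\<^sup>2 / 2) at_top sequentially"
  proof (rule filterlim_at_top_mono[OF filterlim_real_sequentially])
    have "real n \<le> (real n)\<^sup>2 / 2" if "n \<ge> 2" for n
      using mult_right_mono[of 2 "real n" "real n"] that by (simp add: power2_eq_square)
    then show "\<forall>\<^sub>F n in sequentially. real n \<le> (real n)\<^sup>2 / 2"
      by (auto simp: eventually_sequentially)
  qed
  have i3: "incseq real" "filterlim real at_top sequentially"
    by (auto simp: incseq_def filterlim_real_sequentially)
  show ?thesis
    using sup[OF assms i1 i2] sup[OF _ i3, of "\<lambda>x. f (x\<^sup>2 / 2) * ennreal x"] * by simp
qed

text \<open>Evenness folds the integral onto the positive half-line, where the substitution applies.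
  The constants match because \<open>Gamma (1/2) = sqrt pi\<close>.\<close>

lemma nn_integral_half_square_normal:
  fixes f :: "real \<Rightarrow> ennreal"
  assumes [measurable]: "f \<in> borel_measurable borel"
  shows "(\<integral>\<^sup>+x. f (x\<^sup>2 / 2) \<partial>density lborel std_normal_density) =
         (\<integral>\<^sup>+s. gamma_density (1/2) s * f s \<partial>lborel)"
proof -
  have "(\<integral>\<^sup>+x. f (x\<^sup>2 / 2) \<partial>density lborel std_normal_density) =
     (\<integral>\<^sup>+x. std_normal_density x * f (x\<^sup>2 / 2) \<partial>lborel)"
    by (rule nn_integral_density) measurable
  also have "\<dots> = 2 * (\<integral>\<^sup>+x. std_normal_density x * f (x\<^sup>2 / 2) * indicator {0<..} x \<partial>lborel)"
    by (rule nn_integral_even) (auto simp: normal_density_def)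
  also have "\<dots> = (\<integral>\<^sup>+x. 2 * (std_normal_density x * f (x\<^sup>2 / 2) * indicator {0<..} x) \<partial>lborel)"
    by (rule nn_integral_cmult[symmetric]) measurable
  also have "\<dots> = (\<integral>\<^sup>+x. (gamma_density (1/2) (x\<^sup>2 / 2) * f (x\<^sup>2 / 2)) * ennreal x * indicator {0..} x \<partial>lborel)"
  proof (intro nn_integral_cong)
    fix x :: real
    show "2 * (std_normal_density x * f (x\<^sup>2 / 2) * indicator {0<..} x) =
      (gamma_density (1/2) (x\<^sup>2 / 2) * f (x\<^sup>2 / 2)) * ennreal x * indicator {0..} x"
    proof (cases "x > 0")
      case True
      have [simp]: "(x\<^sup>2 / 2) powr - (1/2) = sqrt 2 / x"
        using True by (simp add: powr_minus powr_half_sqrt real_sqrt_divide field_simps)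
      have "gamma_density (1/2) (x\<^sup>2 / 2) * x = 2 * std_normal_density x"
        using True by (simp add: gamma_density_def std_normal_density_def Gamma_one_half_real
            real_sqrt_mult) (simp add: field_simps)
      then have "ennreal (gamma_density (1/2) (x\<^sup>2 / 2)) * ennreal x = 2 * ennreal (std_normal_density x)"
        using True by (simp add: ennreal_mult[symmetric] flip: ennreal_numeral)
      then have "ennreal (gamma_density (1/2) (x\<^sup>2 / 2)) * ennreal x * f (x\<^sup>2 / 2) =
          2 * ennreal (std_normal_density x) * f (x\<^sup>2 / 2)"
        by simp
      with True show ?thesis
        by (simp add: mult_ac)
    qed (auto simp: indicator_def gamma_density_def)
  qed
  also have "\<dots> = (\<integral>\<^sup>+s. gamma_density (1/2) s * f s * indicator {0..} s \<partial>lborel)"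
    by (rule nn_integral_half_square_substitution[symmetric]) measurable
  also have "\<dots> = (\<integral>\<^sup>+s. gamma_density (1/2) s * f s \<partial>lborel)"
    by (intro nn_integral_cong) (auto simp: gamma_density_def indicator_def)
  finally show ?thesis .
qed

section \<open>Orthogonal projections\<close>

text \<open>Resolves the definite description in \<open>orth_proj_def\<close>: two candidates differ
  by a vector of \<open>V\<close> that is orthogonal to itself.\<close>

lemma orth_projI:
  assumes "subspace V" "v \<in> V" "\<And>w. w \<in> V \<Longrightarrow> (y - v) \<bullet> w = 0"
  shows "orth_proj V y = v"
  unfolding orth_proj_def
proof (rule the_equality)
  show "v \<in> V \<and> (\<forall>w\<in>V. (y - v) \<bullet> w = 0)" using assms by auto
next
  fix u assume u: "u \<in> V \<and> (\<forall>w\<in>V. (y - u) \<bullet> w = 0)"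
  then have "u - v \<in> V" using assms subspace_diff by blast
  then have "(y - v) \<bullet> (u - v) - (y - u) \<bullet> (u - v) = 0"
    using u assms(3) by simp
  then have "(u - v) \<bullet> (u - v) = 0"
    by (simp add: inner_diff_left)
  then show "u = v" by simp
qed

lemma
  fixes y :: "'a :: euclidean_space"
  shows orth_proj_in_span: "orth_proj (span S) y \<in> span S"
    and orth_proj_residual: "w \<in> span S \<Longrightarrow> (y - orth_proj (span S) y) \<bullet> w = 0"
proof -
  obtain v r where vr: "v \<in> span S" "\<And>w. w \<in> span S \<Longrightarrow> orthogonal r w" "y = v + r"
    using orthogonal_subspace_decomp_exists[of S y] by blast
  have "orth_proj (span S) y = v"
    by (rule orth_projI) (use vr in \<open>auto simp: orthogonal_def\<close>)
  then show "orth_proj (span S) y \<in> span S" 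
    and "w \<in> span S \<Longrightarrow> (y - orth_proj (span S) y) \<bullet> w = 0"
    using vr by (auto simp: orthogonal_def)
qed

text \<open>One Gram-Schmidt step. If \<open>z\<close> already lies in \<open>span S\<close>, then
  \<open>z' = 0\<close> and the correction term is zero, so the formula covers this case
  too.\<close>

lemma orth_proj_span_insert:
  fixes y z :: "'a :: euclidean_space" and S :: "'a set"
  defines "z' \<equiv> z - orth_proj (span S) z"
  shows "orth_proj (span (insert z S)) y = orth_proj (span S) y + ((y \<bullet> z') / (z' \<bullet> z')) *\<^sub>R z'"
proof (rule orth_projI)
  let ?p = "orth_proj (span S)"
  have sub: "x \<in> span S \<Longrightarrow> x \<in> span (insert z S)" for x
    using span_mono[of S "insert z S"] by auto
  have z': "z' \<in> span (insert z S)"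
    unfolding z'_def by (intro span_diff span_base sub orth_proj_in_span) auto
  show "?p y + ((y \<bullet> z') / (z' \<bullet> z')) *\<^sub>R z' \<in> span (insert z S)"
    by (intro span_add span_scale z' sub orth_proj_in_span)
  fix w assume "w \<in> span (insert z S)"
  then obtain k where k: "w - k *\<^sub>R z \<in> span S"
    by (auto simp: span_breakdown_eq)
  \<comment> \<open>Trading \<open>z\<close> for \<open>z'\<close> splits \<open>w\<close> into
    orthogonal parts, one in \<open>span S\<close> and one along \<open>z'\<close>, against which
    the residual is tested separately.\<close>
  define s where "s = w - k *\<^sub>R z + k *\<^sub>R ?p z"
  have s: "s \<in> span S"
    unfolding s_def by (intro span_add k span_scale orth_proj_in_span)
  have w: "w = s + k *\<^sub>R z'"
    by (simp add: s_def z'_def algebra_simps)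
  have "z' \<bullet> s = 0" "z' \<bullet> ?p y = 0" "(y - ?p y) \<bullet> s = 0"
    unfolding z'_def using s by (auto intro!: orth_proj_residual orth_proj_in_span)
  then show "(y - (?p y + ((y \<bullet> z') / (z' \<bullet> z')) *\<^sub>R z')) \<bullet> w = 0"
    by (simp add: w inner_add inner_diff_left inner_commute[of "?p y"] algebra_simps)
qed (rule subspace_span)

text \<open>Pythagoras for the Gram-Schmidt step. Since \<open>r\<close> is orthogonal to
  \<open>span S\<close>, its inner product with \<open>z'\<close> equals that with \<open>z\<close>.
  If \<open>z' = 0\<close>, this inner product is 0 and the quotient is 0 by convention.\<close>

lemma norm_residual_insert:
  fixes y z :: "'a :: euclidean_space" and S :: "'a set"
  defines "r \<equiv> y - orth_proj (span S) y"
  shows "(norm (y - orth_proj (span (insert z S)) y))\<^sup>2 =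
         (norm r)\<^sup>2 - (r \<bullet> z)\<^sup>2 / (norm (z - orth_proj (span S) z))\<^sup>2"
proof -
  define z' where "z' = z - orth_proj (span S) z"
  have yz: "y \<bullet> z' = r \<bullet> z" "r \<bullet> z' = r \<bullet> z"
    using orth_proj_residual[of "orth_proj (span S) y" S z] orth_proj_in_span[of S y]
      orth_proj_residual[of "orth_proj (span S) z" S y] orth_proj_in_span[of S z]
    by (auto simp: r_def z'_def inner_diff_left inner_diff_right inner_commute)
  have "y - orth_proj (span (insert z S)) y = r - ((r \<bullet> z) / (z' \<bullet> z')) *\<^sub>R z'"
    by (simp add: orth_proj_span_insert yz r_def flip: z'_def)
  also have "(norm \<dots>)\<^sup>2 = (norm r)\<^sup>2 - (r \<bullet> z)\<^sup>2 / (norm z')\<^sup>2"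
    unfolding power2_norm_eq_inner
    by (cases "z' = 0")
       (simp_all add: inner_diff_left inner_diff_right inner_commute[of z' r] yz power2_eq_square)
  finally show ?thesis unfolding z'_def .
qed

text \<open>Gram-Schmidt expresses the projection through measurable operations on projections onto
  the smaller span. The recursion projects the new vector \<open>x i\<close> as well as
  \<open>y\<close>, so the induction lets \<open>y\<close> vary over measurable functions.\<close>

lemma borel_measurable_orth_proj_span:
  fixes x :: "'i \<Rightarrow> 'w \<Rightarrow> 'a :: euclidean_space"
  assumes "finite M" and "\<And>i. i \<in> M \<Longrightarrow> x i \<in> borel_measurable P" and "y \<in> borel_measurable P"
  shows "(\<lambda>\<omega>. orth_proj (span ((\<lambda>i. x i \<omega>) ` M)) (y \<omega>)) \<in> borel_measurable P"
  using assms
proof (induction M arbitrary: y rule: finite_induct)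
  case empty
  have "orth_proj {0} v = 0" for v :: 'a
    by (rule orth_projI) auto
  then show ?case by simp
next
  case (insert i M)
  have [measurable]: "x i \<in> borel_measurable P" "y \<in> borel_measurable P"
    using insert.prems by auto
  have [measurable]: "(\<lambda>\<omega>. orth_proj (span ((\<lambda>i. x i \<omega>) ` M)) (u \<omega>)) \<in> borel_measurable P"
    if "u \<in> borel_measurable P" for u
    using insert that by auto
  show ?case
    by (simp add: orth_proj_span_insert) measurable
qed

section \<open>The standard Gaussian measure\<close>

text \<open>Uniqueness of Haar measure, by Fubini: \<open>\<integral>f(U x) dx * \<integral>g = \<integral>g(U x) dx * \<integral>f\<close>; the
  factors involving \<open>g\<close> cancel for the indicator \<open>g\<close> of the unit ball.\<close>

lemma lborel_orthogonal_invariant: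
  fixes U :: "'a :: euclidean_space \<Rightarrow> 'a" and f :: "'a \<Rightarrow> ennreal"
  assumes U: "orthogonal_transformation U" and [measurable]: "f \<in> borel_measurable borel"
  shows "(\<integral>\<^sup>+x. f (U x) \<partial>lborel) = (\<integral>\<^sup>+x. f x \<partial>lborel)"
proof -
  have lin: "linear U" and "bij U" and norm: "norm (U x) = norm x" for x
    using U by (auto simp: orthogonal_transformation_linear orthogonal_transformation_bij
        orthogonal_transformation_norm)
  have [measurable]: "U \<in> borel_measurable borel"
    by (intro borel_measurable_continuous_onI linear_continuous_on linear_conv_bounded_linear[THEN iffD1] lin)
  have trans: "(\<integral>\<^sup>+x. h (c + x) \<partial>lborel) = (\<integral>\<^sup>+x. h x \<partial>lborel)"
    if [measurable]: "h \<in> borel_measurable borel" for h :: "'a \<Rightarrow> ennreal" and c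
    by (subst (2) lborel_distr_plus[of c, symmetric]) (simp add: nn_integral_distr)
  have refl: "(\<integral>\<^sup>+x. h (c - x) \<partial>lborel) = (\<integral>\<^sup>+x. h x \<partial>lborel)"
    if [measurable]: "h \<in> borel_measurable borel" for h :: "'a \<Rightarrow> ennreal" and c
    by (subst (2) lborel_affine[of "-1" c]) (simp_all add: nn_integral_density nn_integral_distr)
  define g :: "'a \<Rightarrow> ennreal" where "g = indicator (ball 0 1)"
  have [measurable]: "g \<in> borel_measurable borel"
    unfolding g_def by (rule borel_measurable_indicator) simp
  have gU: "g (U x) = g x" for x
    by (simp add: g_def norm indicator_def)
  have g: "(\<integral>\<^sup>+x. g x \<partial>lborel) \<noteq> 0" "(\<integral>\<^sup>+x. g x \<partial>lborel) \<noteq> \<infinity>"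
    using open_not_negligible[of "ball (0::'a) 1"] emeasure_lborel_ball_finite[of "0::'a" 1]
    by (auto simp: g_def negligible_iff_emeasure0)
  have "(\<integral>\<^sup>+x. f (U x) \<partial>lborel) * (\<integral>\<^sup>+y. g y \<partial>lborel) = (\<integral>\<^sup>+x. \<integral>\<^sup>+y. f (U x) * g (U x + y) \<partial>lborel \<partial>lborel)"
    by (simp add: nn_integral_cmult nn_integral_multc trans)
  also have "\<dots> = (\<integral>\<^sup>+y. \<integral>\<^sup>+x. f (U x) * g (U x + y) \<partial>lborel \<partial>lborel)"
    by (rule lborel_pair.Fubini') measurable
  also have "\<dots> = (\<integral>\<^sup>+y. \<integral>\<^sup>+x. f (U x - y) * g x \<partial>lborel \<partial>lborel)"
  proof (rule nn_integral_cong)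
    fix y :: 'a
    \<comment> \<open>Translating \<open>x\<close> by \<open>- inv U y\<close> turns
      \<open>U x\<close> into \<open>U x - y\<close>; the argument of \<open>g\<close> becomes
      \<open>U x\<close>, and \<open>g\<close> is invariant under \<open>U\<close>.\<close>
    have "U (inv U y) = y"
      using \<open>bij U\<close> by (simp add: bij_is_surj surj_f_inv_f)
    then have "U (- inv U y + x) = U x - y" for x
      by (simp add: linear_diff[OF lin])
    then show "(\<integral>\<^sup>+x. f (U x) * g (U x + y) \<partial>lborel) = (\<integral>\<^sup>+x. f (U x - y) * g x \<partial>lborel)"
      by (subst trans[of "\<lambda>x. f (U x) * g (U x + y)" "- inv U y", symmetric]) (auto simp: gU)
  qed
  also have "\<dots> = (\<integral>\<^sup>+x. \<integral>\<^sup>+y. f (U x - y) * g x \<partial>lborel \<partial>lborel)"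
    by (rule lborel_pair.Fubini') measurable
  also have "\<dots> = (\<integral>\<^sup>+x. f x \<partial>lborel) * (\<integral>\<^sup>+y. g y \<partial>lborel)"
    by (simp add: nn_integral_cmult nn_integral_multc refl)
  finally show ?thesis
    using g by (metis infinity_ennreal_def mult_divide_eq_ennreal)
qed

text \<open>Both measures agree on boxes, because the integral of a product of one-variable
  functions factorizes, and boxes determine a finite product measure.\<close>

lemma PiM_density_lborel:
  fixes f :: "real \<Rightarrow> ennreal"
  assumes "finite I" and [measurable]: "f \<in> borel_measurable borel" and "prob_space (density lborel f)"
  shows "Pi\<^sub>M I (\<lambda>_. density lborel f) = density (Pi\<^sub>M I (\<lambda>_. lborel)) (\<lambda>w. \<Prod>i\<in>I. f (w i))"
proof -
  interpret D: prob_space "density lborel f" by fact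
  interpret product_sigma_finite "\<lambda>_. density lborel f" by standard
  interpret L: product_sigma_finite "\<lambda>_. lborel :: real measure" by standard
  show ?thesis
  proof (rule PiM_eqI[symmetric, OF \<open>finite I\<close>])
    show "sets (density (Pi\<^sub>M I (\<lambda>_. lborel)) (\<lambda>w. \<Prod>i\<in>I. f (w i))) = sets (Pi\<^sub>M I (\<lambda>_. density lborel f))"
      by (auto intro!: sets_PiM_cong)
    fix A assume A: "\<And>i. i \<in> I \<Longrightarrow> A i \<in> sets (density lborel f)"
    then have [measurable]: "i \<in> I \<Longrightarrow> A i \<in> sets borel" for i by simp
    have "emeasure (density (Pi\<^sub>M I (\<lambda>_. lborel)) (\<lambda>w. \<Prod>i\<in>I. f (w i))) (Pi\<^sub>E I A) =
        (\<integral>\<^sup>+w. (\<Prod>i\<in>I. f (w i)) * indicator (Pi\<^sub>E I A) w \<partial>Pi\<^sub>M I (\<lambda>_. lborel))"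
      using A by (subst emeasure_density) (auto intro!: sets_PiM_I_finite \<open>finite I\<close>)
    also have "\<dots> = (\<integral>\<^sup>+w. (\<Prod>i\<in>I. f (w i) * indicator (A i) (w i)) \<partial>Pi\<^sub>M I (\<lambda>_. lborel))"
    proof (intro nn_integral_cong)
      fix w assume "w \<in> space (Pi\<^sub>M I (\<lambda>_. lborel :: real measure))"
      then have "indicator (Pi\<^sub>E I A) w = (\<Prod>i\<in>I. indicator (A i) (w i) :: ennreal)"
        using \<open>finite I\<close> by (auto simp: indicator_def space_PiM PiE_iff prod_zero_iff)
      then show "(\<Prod>i\<in>I. f (w i)) * indicator (Pi\<^sub>E I A) w = (\<Prod>i\<in>I. f (w i) * indicator (A i) (w i))"
        by (simp add: prod.distrib)
    qed
    also have "\<dots> = (\<Prod>i\<in>I. \<integral>\<^sup>+x. f x * indicator (A i) x \<partial>lborel)"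
      by (rule L.product_nn_integral_prod) (use \<open>finite I\<close> in auto)
    also have "\<dots> = (\<Prod>i\<in>I. emeasure (density lborel f) (A i))"
      by (intro prod.cong refl emeasure_density[symmetric]) auto
    finally show "emeasure (density (Pi\<^sub>M I (\<lambda>_. lborel)) (\<lambda>w. \<Prod>i\<in>I. f (w i))) (Pi\<^sub>E I A) =
        (\<Prod>i\<in>I. emeasure (density lborel f) (A i))" .
  qed
qed

section \<open>Gaussian vectors in orthonormal coordinates\<close>

definition std_gauss :: "(real ^ 'n) measure" where
  "std_gauss = density lborel (\<lambda>v. ennreal (std_gauss_density v))"

lemma sets_std_gauss [simp, measurable_cong]: "sets std_gauss = sets borel"
  by (simp add: std_gauss_def)

lemma space_std_gauss [simp]: "space std_gauss = UNIV"
  by (simp add: std_gauss_def)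

lemma borel_measurable_std_gauss_density [measurable]:
  "std_gauss_density \<in> borel_measurable borel"
  unfolding std_gauss_density_def[abs_def] by measurable

lemma inner_sum_orthonormal:
  fixes e :: "'b \<Rightarrow> 'a :: real_inner"
  assumes "finite B" and "\<And>b c. b \<in> B \<Longrightarrow> c \<in> B \<Longrightarrow> e b \<bullet> e c = (if b = c then 1 else 0)"
  shows "(\<Sum>b\<in>B. v b *\<^sub>R e b) \<bullet> (\<Sum>b\<in>B. w b *\<^sub>R e b) = (\<Sum>b\<in>B. v b * w b)"
proof -
  have "(\<Sum>b\<in>B. v b *\<^sub>R e b) \<bullet> (\<Sum>b\<in>B. w b *\<^sub>R e b) = (\<Sum>b\<in>B. \<Sum>c\<in>B. if b = c then v b * w c else 0)"
    unfolding inner_sum_left inner_sum_right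
    by (intro sum.cong refl) (simp add: assms(2))
  also have "\<dots> = (\<Sum>b\<in>B. v b * w b)"
    using assms(1) by simp
  finally show ?thesis .
qed

lemma std_gauss_density_Basis:
  "std_gauss_density (\<Sum>b\<in>Basis. w b *\<^sub>R b :: real ^ 'n) = (\<Prod>b\<in>Basis. std_normal_density (w b))"
proof -
  have "(norm (\<Sum>b\<in>Basis. w b *\<^sub>R b :: real ^ 'n))\<^sup>2 = (\<Sum>b\<in>Basis. (w b)\<^sup>2)"
    unfolding power2_norm_eq_inner
    by (subst inner_sum_orthonormal) (auto simp: inner_Basis power2_eq_square)
  then have "exp (- (norm (\<Sum>b\<in>Basis. w b *\<^sub>R b :: real ^ 'n))\<^sup>2 / 2) =
      (\<Prod>b\<in>(Basis :: (real ^ 'n) set). exp (- (w b)\<^sup>2 / 2))"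
    by (simp add: sum_divide_distrib exp_sum flip: sum_negf)
  moreover have "(2 * pi) powr (- real CARD('n) / 2) = (1 / sqrt (2 * pi)) ^ CARD('n)"
  proof -
    have "1 / sqrt (2 * pi) = (2 * pi) powr (- (1/2))"
      by (simp add: powr_minus_divide powr_half_sqrt)
    then show ?thesis
      by (simp add: powr_power)
  qed
  ultimately show ?thesis
    by (simp add: std_gauss_density_def std_normal_density_def prod_dividef power_divide)
qed

text \<open>The coordinates with respect to any orthonormal basis \<open>e\<close> are independent
  standard normal. The map \<open>U\<close> sending \<open>Basis\<close> to \<open>e\<close> is
  orthogonal, so it preserves Lebesgue measure, and it preserves the density, which depends on the
  norm alone.\<close>

lemma nn_integral_std_gauss:
  fixes e :: "real ^ 'n \<Rightarrow> real ^ 'n" and h :: "real ^ 'n \<Rightarrow> ennreal"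
  assumes e: "\<And>b c. b \<in> Basis \<Longrightarrow> c \<in> Basis \<Longrightarrow> e b \<bullet> e c = (if b = c then 1 else 0)"
    and [measurable]: "h \<in> borel_measurable borel"
  shows "(\<integral>\<^sup>+z. h z \<partial>std_gauss) =
         (\<integral>\<^sup>+w. h (\<Sum>b\<in>Basis. w b *\<^sub>R e b) \<partial>Pi\<^sub>M Basis (\<lambda>_. density lborel std_normal_density))"
proof -
  define U where "U x = (\<Sum>b\<in>Basis. (x \<bullet> b) *\<^sub>R e b)" for x
  have "linear U"
    unfolding U_def by (intro linearI)
      (auto simp: inner_add_left scaleR_add_left sum.distrib scaleR_sum_right)
  moreover have "U x \<bullet> U y = x \<bullet> y" for x y
    unfolding U_def using e by (subst inner_sum_orthonormal) (auto simp: euclidean_inner[of x y])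
  ultimately have U: "orthogonal_transformation U"
    by (simp add: orthogonal_transformation_def)
  have [measurable]: "U \<in> borel_measurable borel"
    unfolding U_def by measurable
  have UB: "U (\<Sum>b\<in>Basis. w b *\<^sub>R b) = (\<Sum>b\<in>Basis. w b *\<^sub>R e b)" for w
    unfolding U_def by (intro sum.cong refl) simp
  have dens: "std_gauss_density (U x) = std_gauss_density x" for x
    by (simp add: std_gauss_density_def orthogonal_transformation_norm[OF U])
  have "(\<integral>\<^sup>+z. h z \<partial>std_gauss) = (\<integral>\<^sup>+z. std_gauss_density z * h z \<partial>lborel)"
    unfolding std_gauss_def by (rule nn_integral_density) measurable
  also have "\<dots> = (\<integral>\<^sup>+z. std_gauss_density z * h (U z) \<partial>lborel)"
    by (subst lborel_orthogonal_invariant[OF U, symmetric]) (auto simp: dens)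
  also have "\<dots> = (\<integral>\<^sup>+w. (\<Prod>b\<in>Basis. ennreal (std_normal_density (w b))) * h (\<Sum>b\<in>Basis. w b *\<^sub>R e b)
      \<partial>Pi\<^sub>M Basis (\<lambda>_. lborel))"
    by (subst lborel_eq) (simp add: nn_integral_distr UB std_gauss_density_Basis prod_ennreal)
  also have "\<dots> = (\<integral>\<^sup>+w. h (\<Sum>b\<in>Basis. w b *\<^sub>R e b) \<partial>Pi\<^sub>M Basis (\<lambda>_. density lborel std_normal_density))"
    by (subst PiM_density_lborel)
       (auto simp: nn_integral_density prob_space_normal_density)
  finally show ?thesis .
qed

lemma prob_space_std_gauss: "prob_space (std_gauss :: (real ^ 'n) measure)"
proof
  interpret N: prob_space "density lborel std_normal_density"
    by (rule prob_space_normal_density) simp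
  interpret product_prob_space "\<lambda>_. density lborel std_normal_density" "Basis :: (real ^ 'n) set" ..
  show "emeasure std_gauss (space (std_gauss :: (real ^ 'n) measure)) = 1"
    using nn_integral_std_gauss[where e = "\<lambda>b :: real ^ 'n. b" and h = "\<lambda>_. 1", OF inner_Basis]
      emeasure_space_1
    by simp
qed

text \<open>A proper subspace is Lebesgue null and the Gaussian measure has a density. This excludes
  the degenerate positions of a new vector.\<close>

lemma AE_std_gauss_notin_span:
  fixes S :: "(real ^ 'n) set"
  assumes "dim S < CARD('n)"
  shows "AE z in std_gauss. z \<notin> span S"
proof -
  have "negligible (span S)"
    using assms by (intro negligible_lowdim) simp
  then have "span S \<in> null_sets lborel"
    by (simp add: negligible_iff_null_sets null_sets_completion_iff)
  then have "AE z in lborel. z \<notin> span S"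
    by (rule AE_not_in)
  then show ?thesis
    unfolding std_gauss_def by (subst AE_density) auto
qed

text \<open>The new basis is indexed by \<open>Basis\<close>, as
  \<open>nn_integral_std_gauss\<close> expects. The index \<open>b0\<close> carries
  \<open>u\<close>, the set \<open>A\<close> carries the complement of
  \<open>span (insert u S)\<close>, and the remaining indices carry \<open>span S\<close>.\<close>

lemma adapted_orthonormal_basis:
  fixes S :: "'a :: euclidean_space set"
  assumes "norm u = 1" and "\<forall>v\<in>span S. u \<bullet> v = 0"
  shows "\<exists>(e :: 'a \<Rightarrow> 'a) A b0. (\<forall>b\<in>Basis. \<forall>c\<in>Basis. e b \<bullet> e c = (if b = c then 1 else 0)) \<and>
    A \<subseteq> Basis \<and> b0 \<in> Basis \<and> b0 \<notin> A \<and> e b0 = u \<and> card A + dim S + 1 = DIM('a) \<and>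
    (\<forall>b\<in>Basis - insert b0 A. e b \<in> span S) \<and> (\<forall>b\<in>insert b0 A. \<forall>v\<in>span S. e b \<bullet> v = 0)"
proof -
  note u = assms(1) assms(2)[rule_format]
  \<comment> \<open>\<open>W\<close> is the orthogonal complement of
    \<open>span (insert u S)\<close>; orthonormal bases \<open>C1\<close> of \<open>span S\<close>
    and \<open>C2\<close> of \<open>W\<close> are completed by \<open>u\<close>.\<close>
  define W where "W = {x \<in> UNIV. \<forall>v \<in> span (insert u S). orthogonal v x}"
  obtain C1 where C1: "C1 \<subseteq> span S" "pairwise orthogonal C1" "\<And>x. x \<in> C1 \<Longrightarrow> norm x = 1"
    "independent C1" "card C1 = dim (span S)"
    using orthonormal_basis_subspace[OF subspace_span, of S] by metis
  have "subspace W"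
    unfolding W_def by (auto simp: subspace_def orthogonal_def inner_add_right)
  then obtain C2 where C2: "C2 \<subseteq> W" "pairwise orthogonal C2" "\<And>x. x \<in> C2 \<Longrightarrow> norm x = 1"
    "independent C2" "card C2 = dim W"
    using orthonormal_basis_subspace[of W] by metis
  have "finite C1" "finite C2"
    using C1 C2 independent_imp_finite by auto
  have "u \<notin> span S"
    using u by (metis inner_eq_zero_iff norm_zero zero_neq_one)
  have sub: "x \<in> span S \<Longrightarrow> x \<in> span (insert u S)" for x
    using span_mono[of S "insert u S"] by auto
  have C2_S: "c \<bullet> v = 0" if "c \<in> C2" "v \<in> span S" for c v
    using that C2(1) sub by (auto simp: W_def orthogonal_def inner_commute)
  have C2_u: "c \<bullet> u = 0" if "c \<in> C2" for c
    using that C2(1) span_base[of u "insert u S"] by (auto simp: W_def orthogonal_def inner_commute)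
  have comm: "v \<in> span S \<Longrightarrow> v \<bullet> u = 0" "c \<in> C2 \<Longrightarrow> u \<bullet> c = 0"
    "c \<in> C2 \<Longrightarrow> v \<in> span S \<Longrightarrow> v \<bullet> c = 0" for v c
    using u(2)[of v] C2_u[of c] C2_S[of c v] by (simp_all add: inner_commute)
  have disj: "u \<notin> C2" "C1 \<inter> insert u C2 = {}"
    using C2_u C2_S C1 C2(3) u \<open>u \<notin> span S\<close> by (force simp: norm_eq_1)+
  have "dim W + dim (span (insert u S)) = DIM('a)"
    using dim_subspace_orthogonal_to_vectors[of "span (insert u S)" UNIV] by (simp add: W_def)
  then have card: "card C2 + dim S + 1 = DIM('a)"
    using \<open>u \<notin> span S\<close> C2 by (simp add: dim_insert)
  define E where "E = C1 \<union> insert u C2"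
  \<comment> \<open>The count shows that \<open>E\<close> has as many elements as
    \<open>Basis\<close>, which provides the indexing bijection \<open>e\<close>.\<close>
  have "card E = card C1 + card (insert u C2)"
    unfolding E_def using disj \<open>finite C1\<close> \<open>finite C2\<close> by (intro card_Un_disjoint) auto
  also have "\<dots> = DIM('a)"
    using card disj C1 \<open>finite C2\<close> by simp
  finally obtain e where e: "bij_betw e (Basis :: 'a set) E"
    using finite_same_card_bij[of "Basis :: 'a set" E] \<open>finite C1\<close> \<open>finite C2\<close> by (auto simp: E_def)
  have orth: "x \<bullet> y = (if x = y then 1 else 0)" if "x \<in> E" "y \<in> E" for x y
  proof (cases "x = y")
    case True
    have "norm x = 1"
      using that C1(3) C2(3) u by (auto simp: E_def)
    with True show ?thesis
      by (simp add: norm_eq_1)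
  next
    case False
    then show ?thesis
      using that C1(1,2) C2(2) C2_u C2_S u(2) comm
      by (auto simp: E_def pairwise_def orthogonal_def subset_iff)
  qed
  define b0 where "b0 = inv_into Basis e u"
  define A where "A = {b \<in> Basis. e b \<in> C2}"
  have "u \<in> e ` Basis"
    using e by (auto simp: bij_betw_def E_def)
  then have b0: "b0 \<in> Basis" "e b0 = u"
    by (auto simp: b0_def inv_into_into f_inv_into_f)
  have inj: "inj_on e Basis" and im: "e ` Basis = E"
    using e by (auto simp: bij_betw_def)
  have "e ` A = C2"
    using im by (auto simp: A_def E_def)
  moreover have "inj_on e A"
    by (rule inj_on_subset[OF inj]) (auto simp: A_def)
  ultimately have "card A = card C2"
    using card_image[of e A] by simp
  show ?thesis
  proof (intro exI[of _ e] exI[of _ A] exI[of _ b0] conjI)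
    show "\<forall>b\<in>Basis. \<forall>c\<in>Basis. e b \<bullet> e c = (if b = c then 1 else 0)"
      using orth im inj by (auto simp: inj_on_eq_iff)
    show "b0 \<notin> A" using b0 disj by (auto simp: A_def)
    show "card A + dim S + 1 = DIM('a)" using card \<open>card A = card C2\<close> by simp
    show "\<forall>b\<in>Basis - insert b0 A. e b \<in> span S"
    proof
      fix b assume b: "b \<in> Basis - insert b0 A"
      have "e b \<noteq> u"
        using b b0 inj by (auto simp: inj_on_eq_iff)
      moreover have "e b \<in> E" using b im by auto
      ultimately show "e b \<in> span S"
        using b C1(1) by (auto simp: A_def E_def)
    qed
    show "\<forall>b\<in>insert b0 A. \<forall>v\<in>span S. e b \<bullet> v = 0"
      using b0 u(2) C2_S by (auto simp: A_def)
  qed (use b0 in \<open>auto simp: A_def\<close>)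
qed

text \<open>The chi-square law in gamma form: each further coordinate adds an independent variable
  of shape 1/2. The induction starts from one coordinate, which keeps every shape positive.\<close>

lemma nn_integral_half_sum_squares:
  fixes f :: "real \<Rightarrow> ennreal"
  assumes "finite A" "A \<noteq> {}" "f \<in> borel_measurable borel"
  shows "(\<integral>\<^sup>+w. f (\<Sum>i\<in>A. (w i)\<^sup>2 / 2) \<partial>Pi\<^sub>M A (\<lambda>_. density lborel std_normal_density)) =
         (\<integral>\<^sup>+s. gamma_density (card A / 2) s * f s \<partial>lborel)"
proof -
  interpret N: prob_space "density lborel std_normal_density"
    by (rule prob_space_normal_density) simp
  interpret product_sigma_finite "\<lambda>_. density lborel std_normal_density" ..
  show ?thesis
    using assms
  proof (induction A arbitrary: f rule: finite_ne_induct)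
    case (singleton i)
    note [measurable] = \<open>f \<in> borel_measurable borel\<close>
    show ?case
      using product_nn_integral_singleton[of "\<lambda>x. f (x\<^sup>2 / 2)" i]
      by (simp add: nn_integral_half_square_normal)
  next
    case (insert i A)
    note [measurable] = \<open>f \<in> borel_measurable borel\<close>
    have pos: "real (card A) / 2 > 0"
      using insert by (simp add: card_gt_0_iff)
    have "(\<integral>\<^sup>+w. f (\<Sum>i\<in>insert i A. (w i)\<^sup>2 / 2) \<partial>Pi\<^sub>M (insert i A) (\<lambda>_. density lborel std_normal_density)) =
      (\<integral>\<^sup>+w. \<integral>\<^sup>+x. f ((\<Sum>i\<in>A. (w i)\<^sup>2 / 2) + x\<^sup>2 / 2)
         \<partial>density lborel std_normal_density \<partial>Pi\<^sub>M A (\<lambda>_. density lborel std_normal_density))"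
      using insert.hyps
      by (subst product_nn_integral_insert)
         (auto simp: add.commute intro!: nn_integral_cong arg_cong[where f = f] sum.cong)
    also have "\<dots> = (\<integral>\<^sup>+w. \<integral>\<^sup>+s. gamma_density (1/2) s * f ((\<Sum>i\<in>A. (w i)\<^sup>2 / 2) + s)
         \<partial>lborel \<partial>Pi\<^sub>M A (\<lambda>_. density lborel std_normal_density))"
      by (intro nn_integral_cong nn_integral_half_square_normal) measurable
    also have "\<dots> = (\<integral>\<^sup>+t. gamma_density (card A / 2) t * (\<integral>\<^sup>+s. gamma_density (1/2) s * f (t + s) \<partial>lborel) \<partial>lborel)"
      by (rule insert.IH) measurable
    also have "\<dots> = (\<integral>\<^sup>+s. gamma_density (card A / 2 + 1/2) s * f s \<partial>lborel)"
      by (rule nn_integral_gamma_sum) (use pos in auto)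
    also have "real (card A) / 2 + 1/2 = card (insert i A) / 2"
      using insert.hyps by simp
    finally show ?case .
  qed
qed

text \<open>Halving every square leaves the quotient unchanged and makes it
  \<open>X / (X + Y)\<close> with \<open>X\<close>, \<open>Y\<close> independent gamma variables of
  shapes \<open>card A / 2\<close> and 1/2.\<close>

lemma nn_integral_sum_squares_ratio:
  fixes f :: "real \<Rightarrow> ennreal"
  assumes A: "finite A" "A \<noteq> {}" "i \<notin> A" and [measurable]: "f \<in> borel_measurable borel"
  shows "(\<integral>\<^sup>+w. f ((\<Sum>j\<in>A. (w j)\<^sup>2) / (\<Sum>j\<in>insert i A. (w j)\<^sup>2))
            \<partial>Pi\<^sub>M (insert i A) (\<lambda>_. density lborel std_normal_density)) =
         (\<integral>\<^sup>+t. beta_density (card A / 2) (1/2) t * f t \<partial>lborel)"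
proof -
  interpret N: prob_space "density lborel std_normal_density"
    by (rule prob_space_normal_density) simp
  interpret product_sigma_finite "\<lambda>_. density lborel std_normal_density" ..
  have pos: "real (card A) / 2 > 0"
    using A by (simp add: card_gt_0_iff)
  have "(\<integral>\<^sup>+w. f ((\<Sum>j\<in>A. (w j)\<^sup>2) / (\<Sum>j\<in>insert i A. (w j)\<^sup>2))
            \<partial>Pi\<^sub>M (insert i A) (\<lambda>_. density lborel std_normal_density)) =
     (\<integral>\<^sup>+w. \<integral>\<^sup>+x. f ((\<Sum>j\<in>A. (w j)\<^sup>2 / 2) / ((\<Sum>j\<in>A. (w j)\<^sup>2 / 2) + x\<^sup>2 / 2))
         \<partial>density lborel std_normal_density \<partial>Pi\<^sub>M A (\<lambda>_. density lborel std_normal_density))"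
  proof (subst product_nn_integral_insert[OF A(1,3)], measurable, intro nn_integral_cong arg_cong[where f = f])
    fix w :: "_ \<Rightarrow> real" and x :: real
    have "(\<Sum>j\<in>A. ((w(i := x)) j)\<^sup>2) = (\<Sum>j\<in>A. (w j)\<^sup>2)"
      using A by (intro sum.cong) auto
    then show "(\<Sum>j\<in>A. ((w(i := x)) j)\<^sup>2) / (\<Sum>j\<in>insert i A. ((w(i := x)) j)\<^sup>2) =
        (\<Sum>j\<in>A. (w j)\<^sup>2 / 2) / ((\<Sum>j\<in>A. (w j)\<^sup>2 / 2) + x\<^sup>2 / 2)"
      using A by (simp add: add.commute flip: sum_divide_distrib add_divide_distrib)
  qed
  also have "\<dots> = (\<integral>\<^sup>+w. \<integral>\<^sup>+s. gamma_density (1/2) s * f ((\<Sum>j\<in>A. (w j)\<^sup>2 / 2) / ((\<Sum>j\<in>A. (w j)\<^sup>2 / 2) + s))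
         \<partial>lborel \<partial>Pi\<^sub>M A (\<lambda>_. density lborel std_normal_density))"
    by (intro nn_integral_cong nn_integral_half_square_normal) measurable
  also have "\<dots> = (\<integral>\<^sup>+t. gamma_density (card A / 2) t * (\<integral>\<^sup>+s. gamma_density (1/2) s * f (t / (t + s)) \<partial>lborel) \<partial>lborel)"
    using A by (intro nn_integral_half_sum_squares) auto
  also have "\<dots> = (\<integral>\<^sup>+t. beta_density (card A / 2) (1/2) t * f t \<partial>lborel)"
    by (rule nn_integral_gamma_ratio) (use pos in auto)
  finally show ?thesis .
qed

section \<open>Residual sums of squares\<close>

lemma norm_residual_pos:
  fixes y :: "'a :: euclidean_space"
  assumes "y \<notin> span S"
  shows "norm (y - orth_proj (span S) y) > 0"
proof -
  have "y \<noteq> orth_proj (span S) y"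
    using assms orth_proj_in_span[of S y] by metis
  then show ?thesis by simp
qed

text \<open>The case of a single Gaussian vector. In the adapted basis, \<open>p z\<close> is the
  sum of squared coordinates over \<open>insert b0 A\<close> and \<open>u \<bullet> z\<close> is the
  coordinate at \<open>b0\<close>, so subtracting its square leaves the sum over
  \<open>A\<close>.\<close>

lemma nn_integral_residual_ratio_insert:
  fixes S :: "(real ^ 'n) set" and f :: "real \<Rightarrow> ennreal"
  assumes y: "y \<notin> span S" and dim: "dim S + 1 < CARD('n)"
    and [measurable]: "f \<in> borel_measurable borel"
  shows "(\<integral>\<^sup>+z. f ((norm (y - orth_proj (span (insert z S)) y))\<^sup>2 / (norm (y - orth_proj (span S) y))\<^sup>2) \<partial>std_gauss) =
         (\<integral>\<^sup>+t. beta_density ((real CARD('n) - dim S - 1) / 2) (1/2) t * f t \<partial>lborel)"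
proof -
  define r where "r = y - orth_proj (span S) y"
  define u where "u = r /\<^sub>R norm r"
  have r: "norm r > 0"
    unfolding r_def using y by (rule norm_residual_pos)
  have u: "norm u = 1" "\<forall>v\<in>span S. u \<bullet> v = 0"
    using r orth_proj_residual[of _ S y] by (auto simp: u_def r_def)
  have ru: "r = norm r *\<^sub>R u"
    using r by (simp add: u_def)
  obtain e :: "real ^ 'n \<Rightarrow> real ^ 'n" and A b0 where
    e: "\<forall>b\<in>Basis. \<forall>c\<in>Basis. e b \<bullet> e c = (if b = c then 1 else 0)"
    and A: "A \<subseteq> Basis" "b0 \<in> Basis" "b0 \<notin> A" "e b0 = u" "card A + dim S + 1 = DIM(real ^ 'n)"
    and eS: "\<forall>b\<in>Basis - insert b0 A. e b \<in> span S"
    and eA: "\<forall>b\<in>insert b0 A. \<forall>v\<in>span S. e b \<bullet> v = 0"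
    using adapted_orthonormal_basis[OF u] by blast
  have finA: "finite A" "A \<noteq> {}"
    using A dim by (auto intro: finite_subset[OF _ finite_Basis])
  define p where "p z = (norm (z - orth_proj (span S) z))\<^sup>2" for z :: "real ^ 'n"
  have [measurable]: "p \<in> borel_measurable borel"
  proof -
    \<comment> \<open>The set \<open>S\<close> may be infinite, so a finite set with the same span
      is used for the measurability of the projection.\<close>
    obtain B where B: "finite B" "span B = span S"
      using basis_subspace_exists[OF subspace_span, of S] by (metis)
    have "(\<lambda>z. orth_proj (span ((\<lambda>b. b) ` B)) z) \<in> borel_measurable borel"
      by (rule borel_measurable_orth_proj_span) (use B in auto)
    then have [measurable]: "orth_proj (span S) \<in> borel_measurable borel"
      using B by simp
    show ?thesis unfolding p_def by measurable
  qed
  have "(\<integral>\<^sup>+z. f ((norm (y - orth_proj (span (insert z S)) y))\<^sup>2 / (norm (y - orth_proj (span S) y))\<^sup>2) \<partial>std_gauss) =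
    (\<integral>\<^sup>+z. f ((p z - (u \<bullet> z)\<^sup>2) / p z) \<partial>std_gauss)"
  proof (rule nn_integral_cong_AE)
    have "AE z in std_gauss. z \<notin> span S"
      using dim by (intro AE_std_gauss_notin_span) simp
    then show "AE z in std_gauss. f ((norm (y - orth_proj (span (insert z S)) y))\<^sup>2 / (norm (y - orth_proj (span S) y))\<^sup>2) =
        f ((p z - (u \<bullet> z)\<^sup>2) / p z)"
    proof eventually_elim
      case (elim z)
      then have "p z > 0"
        unfolding p_def using norm_residual_pos[of z S] by simp
      moreover have "r \<bullet> z = norm r * (u \<bullet> z)"
        by (subst ru) simp
      ultimately show ?case
        using r by (simp add: norm_residual_insert power_mult_distrib diff_divide_distrib
            flip: r_def p_def)
    qed
  qed
  also have "\<dots> = (\<integral>\<^sup>+w. f ((\<Sum>b\<in>A. (w b)\<^sup>2) / (\<Sum>b\<in>insert b0 A. (w b)\<^sup>2))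
      \<partial>Pi\<^sub>M Basis (\<lambda>_. density lborel std_normal_density))"
  proof (subst nn_integral_std_gauss[OF e[rule_format]], assumption, assumption, measurable, intro nn_integral_cong arg_cong[where f = f])
    fix w :: "real ^ 'n \<Rightarrow> real"
    define z where "z = (\<Sum>b\<in>Basis. w b *\<^sub>R e b)"
    \<comment> \<open>The terms of \<open>z\<close> in \<open>span S\<close> sum to
      \<open>v\<close>; the others are orthogonal to \<open>span S\<close>, so \<open>v\<close> is
      the projection of \<open>z\<close>.\<close>
    define v where "v = (\<Sum>b\<in>Basis - insert b0 A. w b *\<^sub>R e b)"
    have z: "z = v + (\<Sum>b\<in>insert b0 A. w b *\<^sub>R e b)"
      unfolding z_def v_def using A by (intro sum.subset_diff) auto
    have "orth_proj (span S) z = v"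
    proof (rule orth_projI)
      show "v \<in> span S"
        unfolding v_def by (intro span_sum span_scale eS[rule_format])
      show "(z - v) \<bullet> x = 0" if "x \<in> span S" for x
        unfolding z using that by (simp add: inner_sum_left eA del: sum.insert)
    qed simp
    then have "z - orth_proj (span S) z = (\<Sum>b\<in>insert b0 A. w b *\<^sub>R e b)"
      using z by (metis add_diff_cancel_left')
    then have "p z = (\<Sum>b\<in>insert b0 A. w b *\<^sub>R e b) \<bullet> (\<Sum>b\<in>insert b0 A. w b *\<^sub>R e b)"
      by (simp only: p_def power2_norm_eq_inner)
    also have "\<dots> = (\<Sum>b\<in>insert b0 A. w b * w b)"
    proof (rule inner_sum_orthonormal)
      show "e b \<bullet> e c = (if b = c then 1 else 0)" if "b \<in> insert b0 A" "c \<in> insert b0 A" for b c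
        using that A(1,2) e by blast
    qed (use finA in simp)
    finally have "p z = (\<Sum>b\<in>insert b0 A. (w b)\<^sup>2)"
      by (simp only: power2_eq_square)
    moreover have "u \<bullet> z = w b0"
      using A by (simp add: z_def inner_sum_right e if_distrib sum.delta flip: A(4) cong: if_cong)
    ultimately show "(p z - (u \<bullet> z)\<^sup>2) / p z = (\<Sum>b\<in>A. (w b)\<^sup>2) / (\<Sum>b\<in>insert b0 A. (w b)\<^sup>2)"
      using A finA by simp
  qed
  also have "\<dots> = (\<integral>\<^sup>+w. f ((\<Sum>b\<in>A. (w b)\<^sup>2) / (\<Sum>b\<in>insert b0 A. (w b)\<^sup>2))
      \<partial>Pi\<^sub>M (insert b0 A) (\<lambda>_. density lborel std_normal_density))"
  \<comment> \<open>The coordinates outside \<open>insert b0 A\<close> do not occur in the integrand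
    and integrate out, each being governed by a probability measure.\<close>
  proof -
    interpret N: prob_space "density lborel std_normal_density"
      by (rule prob_space_normal_density) simp
    interpret product_prob_space "\<lambda>_. density lborel std_normal_density" "Basis :: (real ^ 'n) set" ..
    show ?thesis
      using A finA
      by (subst distr_restrict[of "insert b0 A" "Basis :: (real ^ 'n) set"])
         (auto simp: nn_integral_distr measurable_restrict_subset simp del: sum.insert)
  qed
  also have "\<dots> = (\<integral>\<^sup>+t. beta_density (card A / 2) (1/2) t * f t \<partial>lborel)"
    using A finA by (intro nn_integral_sum_squares_ratio) auto
  also have "real (card A) = real CARD('n) - dim S - 1"
    using A(5) by (simp flip: of_nat_add of_nat_Suc)
  finally show ?thesis .
qed

text \<open>The vectors of \<open>S\<close> are treated as constant random vectors, indexed together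
  with the random ones by the disjoint sum \<open>J <+> S\<close>.\<close>

lemma borel_measurable_residual:
  fixes y :: "'a :: euclidean_space"
  assumes "finite J" "finite S" "\<And>i. i \<in> J \<Longrightarrow> x i \<in> borel_measurable P"
  shows "(\<lambda>\<omega>. (norm (y - orth_proj (span ((\<lambda>i. x i \<omega>) ` J \<union> S)) y))\<^sup>2) \<in> borel_measurable P"
proof -
  have "(\<lambda>\<omega>. orth_proj (span ((\<lambda>k. case_sum x (\<lambda>s _. s) k \<omega>) ` (J <+> S))) y) \<in> borel_measurable P"
    by (rule borel_measurable_orth_proj_span) (use assms in auto)
  moreover have "(\<lambda>k. case_sum x (\<lambda>s _. s) k \<omega>) ` (J <+> S) = (\<lambda>i. x i \<omega>) ` J \<union> S" for \<omega>
    by (force simp: Plus_def)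
  ultimately have [measurable]: "(\<lambda>\<omega>. orth_proj (span ((\<lambda>i. x i \<omega>) ` J \<union> S)) y) \<in> borel_measurable P"
    by simp
  show ?thesis by measurable
qed

text \<open>Induction on \<open>J\<close> with \<open>S\<close> and \<open>f\<close> arbitrary: once
  \<open>z\<close> is held fixed it joins the fixed vectors, so the hypothesis is applied to
  \<open>insert z S\<close>, with the factor \<open>R (insert z S) / R S\<close> absorbed into the
  test function.\<close>

lemma nn_integral_residual_ratio:
  fixes S :: "(real ^ 'n) set" and f :: "real \<Rightarrow> ennreal" and J :: "'i set"
  assumes "finite J" "J \<noteq> {}" "finite S" "y \<notin> span S" "dim S + card J < CARD('n)"
    and "f \<in> borel_measurable borel"
  shows "(\<integral>\<^sup>+w. f ((norm (y - orth_proj (span (w ` J \<union> S)) y))\<^sup>2 / (norm (y - orth_proj (span S) y))\<^sup>2)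
            \<partial>Pi\<^sub>M J (\<lambda>_. std_gauss)) =
         (\<integral>\<^sup>+t. beta_density ((real CARD('n) - dim S - card J) / 2) (card J / 2) t * f t \<partial>lborel)"
proof -
  interpret G: prob_space "std_gauss :: (real ^ 'n) measure"
    by (rule prob_space_std_gauss)
  interpret product_sigma_finite "\<lambda>_ :: 'i. std_gauss :: (real ^ 'n) measure" ..
  define R where "R T = (norm (y - orth_proj (span T) y))\<^sup>2" for T
  have meas: "(\<lambda>w. R (w ` J \<union> S)) \<in> borel_measurable (Pi\<^sub>M J (\<lambda>_. std_gauss))"
    if "finite J" "finite S" for J :: "'i set" and S
    unfolding R_def by (rule borel_measurable_residual) (use that in auto)
  have meas1: "(\<lambda>z. R (insert z S)) \<in> borel_measurable borel" if "finite S" for S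
    using borel_measurable_residual[of "{()}" S "\<lambda>_ z. z" borel y] that by (simp add: R_def)
  show ?thesis
    using assms unfolding R_def[symmetric]
  proof (induction J arbitrary: S f rule: finite_ne_induct)
    case (singleton i)
    note [measurable] = meas1[OF \<open>finite S\<close>] \<open>f \<in> borel_measurable borel\<close>
    have "(\<integral>\<^sup>+w. f (R (w ` {i} \<union> S) / R S) \<partial>Pi\<^sub>M {i} (\<lambda>_. std_gauss)) = (\<integral>\<^sup>+z. f (R (insert z S) / R S) \<partial>std_gauss)"
      using product_nn_integral_singleton[of "\<lambda>z. f (R (insert z S) / R S)" i] by simp
    also have "\<dots> = (\<integral>\<^sup>+t. beta_density ((real CARD('n) - dim S - 1) / 2) (1/2) t * f t \<partial>lborel)"
      unfolding R_def by (rule nn_integral_residual_ratio_insert) (use singleton in auto)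
    finally show ?case by simp
  next
    case (insert i J)
    note [measurable] = meas[OF _ \<open>finite S\<close>] meas1[OF \<open>finite S\<close>] \<open>f \<in> borel_measurable borel\<close>
    have J: "card J > 0"
      using insert.hyps by (simp add: card_gt_0_iff)
    define a where "a = (real CARD('n) - dim S - card (insert i J)) / 2"
    define b where "b = real (card J) / 2"
    have ab: "a > 0" "b > 0" "a + b = (real CARD('n) - dim S - 1) / 2"
      using insert.prems(3) insert.hyps J by (auto simp: a_def b_def field_simps)
    \<comment> \<open>\<open>g q\<close> is the expected value of \<open>f\<close> at
      \<open>q\<close> times a beta variable, where \<open>q\<close> is the factor contributed by
      the first vector.\<close>
    define g where "g q = (\<integral>\<^sup>+t. beta_density a b t * f (t * q) \<partial>lborel)" for q
    have [measurable]: "g \<in> borel_measurable borel"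
      unfolding g_def by measurable
    have "(\<integral>\<^sup>+w. f (R (w ` insert i J \<union> S) / R S) \<partial>Pi\<^sub>M (insert i J) (\<lambda>_. std_gauss)) =
        (\<integral>\<^sup>+z. \<integral>\<^sup>+w. f (R (w ` J \<union> insert z S) / R S) \<partial>Pi\<^sub>M J (\<lambda>_. std_gauss) \<partial>std_gauss)"
    proof (subst product_nn_integral_insert_rev)
      have "(w(i := z)) ` insert i J \<union> S = w ` J \<union> insert z S" for w :: "'i \<Rightarrow> real ^ 'n" and z
        using insert.hyps by auto
      then show "(\<integral>\<^sup>+z. \<integral>\<^sup>+w. f (R ((w(i := z)) ` insert i J \<union> S) / R S) \<partial>Pi\<^sub>M J (\<lambda>_. std_gauss) \<partial>std_gauss) =
        (\<integral>\<^sup>+z. \<integral>\<^sup>+w. f (R (w ` J \<union> insert z S) / R S) \<partial>Pi\<^sub>M J (\<lambda>_. std_gauss) \<partial>std_gauss)"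
        by simp
    qed (use insert.hyps meas[OF _ \<open>finite S\<close>, of "insert i J"] in auto)
    also have "\<dots> = (\<integral>\<^sup>+z. g (R (insert z S) / R S) \<partial>std_gauss)"
    proof (rule nn_integral_cong_AE)
      \<comment> \<open>Avoiding \<open>span (insert y S)\<close> serves twice: \<open>z\<close>
        raises the dimension of the span by one, and by exchange \<open>y\<close> stays outside
        \<open>span (insert z S)\<close>.\<close>
      have "dim (insert y S) < CARD('n)"
        using insert.prems(3) insert.hyps J by (auto simp: dim_insert)
      then have "AE z in std_gauss. z \<notin> span (insert y S)"
        by (rule AE_std_gauss_notin_span)
      then show "AE z in std_gauss. (\<integral>\<^sup>+w. f (R (w ` J \<union> insert z S) / R S) \<partial>Pi\<^sub>M J (\<lambda>_. std_gauss)) =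
          g (R (insert z S) / R S)"
      proof eventually_elim
        case (elim z)
        have zS: "z \<notin> span S"
          using elim span_mono[of S "insert y S"] by auto
        have yz: "y \<notin> span (insert z S)"
          using elim insert.prems(2) in_span_insert[of y z S] by auto
        \<comment> \<open>Positivity allows the ratio to be expanded by
          \<open>R (insert z S)\<close> into a product of two ratios.\<close>
        have "R (insert z S) > 0"
          unfolding R_def using norm_residual_pos[OF yz] by simp
        then have "(\<integral>\<^sup>+w. f (R (w ` J \<union> insert z S) / R S) \<partial>Pi\<^sub>M J (\<lambda>_. std_gauss)) =
          (\<integral>\<^sup>+w. f (R (w ` J \<union> insert z S) / R (insert z S) * (R (insert z S) / R S)) \<partial>Pi\<^sub>M J (\<lambda>_. std_gauss))"
          by simp
        also have "\<dots> = (\<integral>\<^sup>+t. beta_density ((real CARD('n) - dim (insert z S) - card J) / 2) (card J / 2) t *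
            f (t * (R (insert z S) / R S)) \<partial>lborel)"
          by (rule insert.IH) (use insert.prems insert.hyps yz zS in \<open>auto simp: dim_insert\<close>)
        also have "(real CARD('n) - dim (insert z S) - card J) / 2 = a"
          using zS insert.hyps by (simp add: a_def dim_insert)
        finally show ?case
          by (simp add: g_def b_def)
      qed
    qed
    also have "\<dots> = (\<integral>\<^sup>+s. beta_density (a + b) (1/2) s * g s \<partial>lborel)"
      unfolding R_def ab(3)
      by (rule nn_integral_residual_ratio_insert) (use insert.prems insert.hyps J in auto)
    also have "\<dots> = (\<integral>\<^sup>+t. beta_density a (b + 1/2) t * f t \<partial>lborel)"
      unfolding g_def by (rule nn_integral_beta_product) (use ab in auto)
    also have "b + 1/2 = card (insert i J) / 2"
      using insert.hyps by (simp add: b_def)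
    finally show ?case
      by (simp only: a_def)
  qed
qed

section \<open>Transfer to random vectors on a probability space\<close>

theorem theorem1:
  fixes P :: "'w measure"
    and Nstar N :: "'i set"
    and y :: "real ^ 'n"
    and xfix :: "'i \<Rightarrow> real ^ 'n"
    and z :: "'i \<Rightarrow> 'w \<Rightarrow> real ^ 'n"
  assumes "prob_space P"
    and "finite Nstar"
    and "N \<subset> Nstar"
    and "card N < card Nstar" and "card Nstar < CARD('n)"
    and "inj_on xfix N" and "y \<notin> xfix ` N" and "independent (insert y (xfix ` N))"
    and "prob_space.indep_vars P (\<lambda>_. borel) z (Nstar - N)"
    and "\<And>\<nu>. \<nu> \<in> Nstar - N \<Longrightarrow> distributed P lborel (z \<nu>) (\<lambda>v. ennreal (std_gauss_density v))"
  shows "(\<lambda>\<omega>. SS (\<lambda>\<nu>. if \<nu> \<in> N then xfix \<nu> else z \<nu> \<omega>) y Nstar) \<in> borel_measurable P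
       \<and> distributed P lborel
           (\<lambda>\<omega>. SS (\<lambda>\<nu>. if \<nu> \<in> N then xfix \<nu> else z \<nu> \<omega>) y Nstar / SS xfix y N)
           (\<lambda>u. ennreal (beta_density ((real CARD('n) - real (card Nstar)) / 2)
                                      ((real (card Nstar) - real (card N)) / 2) u))"
proof -
  interpret prob_space P by fact
  define J where "J = Nstar - N"
  define S where "S = xfix ` N"
  define R where "R T = (norm (y - orth_proj (span T) y))\<^sup>2" for T
  have J: "finite J" "J \<noteq> {}" "card Nstar = card N + card J"
    using assms(2-4) by (auto simp: J_def card_Diff_subset finite_subset card_mono)
  \<comment> \<open>Linear independence enters here: \<open>y\<close> has a nonzero residual, and
    the fixed vectors span a space of dimension \<open>card N\<close>.\<close>
  have S: "finite S" "y \<notin> span S" "dim S = card N"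
    using assms(2,3,6-8) by (auto simp: S_def independent_insert dim_eq_card_independent card_image
        intro: finite_subset)
  have z [measurable]: "z \<nu> \<in> borel_measurable P" if "\<nu> \<in> J" for \<nu>
    using distributed_measurable[OF assms(10)] that by (simp add: J_def)
  have im: "(\<lambda>\<nu>. if \<nu> \<in> N then xfix \<nu> else z \<nu> \<omega>) ` Nstar = (\<lambda>\<nu>. z \<nu> \<omega>) ` J \<union> S" for \<omega>
    using assms(3) by (auto simp: J_def S_def)
  have SS: "SS (\<lambda>\<nu>. if \<nu> \<in> N then xfix \<nu> else z \<nu> \<omega>) y Nstar = R ((\<lambda>\<nu>. z \<nu> \<omega>) ` J \<union> S)" for \<omega>
    by (simp only: SS_def R_def im)
  have SSN: "SS xfix y N = R S"
    by (simp add: SS_def R_def S_def)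
  have [measurable]: "(\<lambda>\<omega>. R ((\<lambda>\<nu>. z \<nu> \<omega>) ` J \<union> S)) \<in> borel_measurable P"
    unfolding R_def by (rule borel_measurable_residual) (use J S z in auto)
  have [measurable]: "(\<lambda>w. R (w ` J \<union> S)) \<in> borel_measurable (Pi\<^sub>M J (\<lambda>_. borel))"
    unfolding R_def by (rule borel_measurable_residual) (use J S in auto)
  have "distr P borel (z \<nu>) = std_gauss" if "\<nu> \<in> J" for \<nu>
    using distributed_distr_eq_density[OF assms(10)] that
    by (simp add: J_def std_gauss_def cong: distr_cong)
  \<comment> \<open>Independence makes the joint law the product of the marginals, which are all
    \<open>std_gauss\<close>.\<close>
  moreover have "distr P (Pi\<^sub>M J (\<lambda>_. borel)) (\<lambda>\<omega>. \<lambda>\<nu>\<in>J. z \<nu> \<omega>) = Pi\<^sub>M J (\<lambda>\<nu>. distr P borel (z \<nu>))"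
    using indep_vars_iff_distr_eq_PiM'[OF J(2), of z "\<lambda>_. borel"] z assms(9) by (simp add: J_def)
  ultimately have joint: "distr P (Pi\<^sub>M J (\<lambda>_. borel)) (\<lambda>\<omega>. \<lambda>\<nu>\<in>J. z \<nu> \<omega>) = Pi\<^sub>M J (\<lambda>_. std_gauss)"
    by (simp cong: PiM_cong)
  define \<beta> where "\<beta> = (\<lambda>u. ennreal (beta_density ((real CARD('n) - real (card Nstar)) / 2)
                                      ((real (card Nstar) - real (card N)) / 2) u))"
  have [measurable]: "\<beta> \<in> borel_measurable borel"
    unfolding \<beta>_def by measurable
  have "distr P lborel (\<lambda>\<omega>. R ((\<lambda>\<nu>. z \<nu> \<omega>) ` J \<union> S) / R S) = density lborel \<beta>"
  proof (rule measure_eqI)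
    fix A assume "A \<in> sets (distr P lborel (\<lambda>\<omega>. R ((\<lambda>\<nu>. z \<nu> \<omega>) ` J \<union> S) / R S))"
    then have [measurable]: "A \<in> sets borel" by simp
    have "emeasure (distr P lborel (\<lambda>\<omega>. R ((\<lambda>\<nu>. z \<nu> \<omega>) ` J \<union> S) / R S)) A =
        (\<integral>\<^sup>+\<omega>. indicator A (R ((\<lambda>\<nu>. z \<nu> \<omega>) ` J \<union> S) / R S) \<partial>P)"
      using nn_integral_distr[of "\<lambda>\<omega>. R ((\<lambda>\<nu>. z \<nu> \<omega>) ` J \<union> S) / R S" P lborel "indicator A"]
      by simp
    \<comment> \<open>Restricting the family to \<open>J\<close> does not change its image of
      \<open>J\<close>, and it gives an element of the product space.\<close>
    also have "\<dots> = (\<integral>\<^sup>+\<omega>. indicator A (R ((\<lambda>\<nu>\<in>J. z \<nu> \<omega>) ` J \<union> S) / R S) \<partial>P)"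
      by simp
    also have "\<dots> = (\<integral>\<^sup>+w. indicator A (R (w ` J \<union> S) / R S)
        \<partial>distr P (Pi\<^sub>M J (\<lambda>_. borel)) (\<lambda>\<omega>. \<lambda>\<nu>\<in>J. z \<nu> \<omega>))"
    proof (rule nn_integral_distr[symmetric])
      show "(\<lambda>\<omega>. \<lambda>\<nu>\<in>J. z \<nu> \<omega>) \<in> measurable P (Pi\<^sub>M J (\<lambda>_. borel))"
        by (rule measurable_restrict) (rule z)
    qed measurable
    also have "\<dots> = (\<integral>\<^sup>+t. ennreal (beta_density ((real CARD('n) - dim S - card J) / 2) (card J / 2) t) * indicator A t \<partial>lborel)"
      unfolding joint R_def by (rule nn_integral_residual_ratio) (use J S assms(5) in auto)
    also have "\<dots> = (\<integral>\<^sup>+t. \<beta> t * indicator A t \<partial>lborel)"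
      \<comment> \<open>Since \<open>card Nstar = card N + card J\<close>, subtracting
        \<open>dim S = card N\<close> and \<open>card J\<close> from the ambient dimension amounts
        to subtracting \<open>card Nstar\<close>.\<close>
      by (simp add: \<beta>_def J S diff_diff_eq)
    also have "\<dots> = emeasure (density lborel \<beta>) A"
      by (simp add: emeasure_density)
    finally show "emeasure (distr P lborel (\<lambda>\<omega>. R ((\<lambda>\<nu>. z \<nu> \<omega>) ` J \<union> S) / R S)) A =
        emeasure (density lborel \<beta>) A" .
  qed simp
  then show ?thesis
    unfolding SS SSN \<beta>_def[symmetric] by (simp add: distributed_def)
qed

end
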